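(* A bi-infinite sequence of positive integers is the quiddity sequence of a positive infinite frieze if and only if it is acyclic.
   Context: An $\mathrm{SL}_2$-tiling is a function $\mathbf{M}\colon\mathbb{Z}\times\mathbb{Z}\to\mathbb{Z}$, with $m_{i,j}=\mathbf{M}(i,j)$, such that $m_{i,j}m_{i+1,j+1}-m_{i,j+1}m_{i+1,j}=1$ for all $i,j\in\mathbb{Z}$. A positive infinite frieze is an $\mathrm{SL}_2$-tiling $\mathbf{M}$ with $m_{j,i}=-m_{i,j}$ for all $i,j\in\mathbb{Z}$ and $m_{i,j}>0$ whenever $i>j$ (so $m_{i+1,i}=1$ for all $i$). Its quiddity sequence is the bi-infinite sequence $(m_{i+1,i-1})_{i\in\mathbb{Z}}$. A positive frieze of order $n$ is a finite array of $n+1$ bi-infinite rows of integers, each row shifted by half a step relative to the row above, in which the first and last rows consist of zeros, all other entries are positive, and any four entries forming a diamond with left entry $a$, top entry $b$, bottom entry $c$ and right entry $d$ satisfy $ad-bc=1$. The third row of a positive frieze of order $n$ is periodic with period $n$; its quiddity cycle is the set of cyclically equivalent finite sequences given by $n$ consecutive terms of the third row. (By Conway and Coxeter, the quiddity cycles of positive friezes of order $n\geq3$ are exactly the cycles obtained from convex $n$-gons triangulated by non-crossing diagonals by listing, clockwise around the polygon, the numbers of triangles incident to each vertex.) A cycle sequence is a finite sequence of positive integers obtained by removing the final term from any one of the cyclically equivalent sequences that make up the quiddity cycle of some positive frieze. (For example, $1,2,2,3,1,2$ is a cycle sequence obtained from the quiddity cycle of $1,2,2,3,1,2,4$.) A bi-infinite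 sequence of integers $w$ is acyclic if no cycle sequence appears as a finite subsequence of contiguous terms of $w$. *)

theory Defs
  imports Main
begin

definition SL2_tiling :: "(int \<Rightarrow> int \<Rightarrow> int) \<Rightarrow> bool" where
  "SL2_tiling M \<longleftrightarrow> (\<forall>i j. M i j * M (i + 1) (j + 1) - M i (j + 1) * M (i + 1) j = 1)"

definition positive_infinite_frieze :: "(int \<Rightarrow> int \<Rightarrow> int) \<Rightarrow> bool" where
  "positive_infinite_frieze M \<longleftrightarrow>
     SL2_tiling M \<and> (\<forall>i j. M j i = - M i j) \<and> (\<forall>i j. i > j \<longrightarrow> M i j > 0)"

definition quiddity_sequence :: "(int \<Rightarrow> int \<Rightarrow> int) \<Rightarrow> int \<Rightarrow> int" where
  "quiddity_sequence M = (\<lambda>i. M (i + 1) (i - 1))"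

text \<open>
  The rows of a frieze of order \<open>n\<close> are numbered \<open>0, \<dots>, n\<close> from top to bottom, and \<open>F r k\<close> is
  the entry of row \<open>r\<close> at horizontal position \<open>k + r / 2\<close>.  So the diamond with top entry
  \<open>F r k\<close> has left entry \<open>F (r + 1) (k - 1)\<close>, right entry \<open>F (r + 1) k\<close> and bottom entry
  \<open>F (r + 2) (k - 1)\<close>.  The values \<open>F r k\<close> with \<open>r > n\<close> are irrelevant.  The condition
  \<open>n \<ge> 2\<close> ensures that there is a third row, \<open>F 2\<close>.
\<close>

definition positive_frieze :: "nat \<Rightarrow> (nat \<Rightarrow> int \<Rightarrow> int) \<Rightarrow> bool" where
  "positive_frieze n F \<longleftrightarrow>
     n \<ge> 2 \<and>
     (\<forall>k. F 0 k = 0) \<and> (\<forall>k. F n k = 0) \<and>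
     (\<forall>r k. 0 < r \<and> r < n \<longrightarrow> F r k > 0) \<and>
     (\<forall>r k. r + 2 \<le> n \<longrightarrow>
        F (r + 1) (k - 1) * F (r + 1) k - F r k * F (r + 2) (k - 1) = 1)"

definition window :: "(int \<Rightarrow> 'a) \<Rightarrow> int \<Rightarrow> nat \<Rightarrow> 'a list" where
  "window w k n = map w [k..k + int n - 1]"

text \<open>
  Since the third row of a positive frieze of order \<open>n\<close> has period \<open>n\<close>, its windows of length
  \<open>n\<close> are exactly the rotations of any one of them.
\<close>

definition quiddity_cycle :: "nat \<Rightarrow> (nat \<Rightarrow> int \<Rightarrow> int) \<Rightarrow> int list set" where
  "quiddity_cycle n F = {window (F 2) k n | k. True}"

text \<open>
  Positivity of the terms excludes exactly the order \<open>n = 2\<close>, where the third row is the last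
  row and consists of zeros.
\<close>

definition cycle_sequence :: "int list \<Rightarrow> bool" where
  "cycle_sequence xs \<longleftrightarrow>
     (\<forall>x\<in>set xs. x > 0) \<and>
     (\<exists>n F. positive_frieze n F \<and> (\<exists>ys\<in>quiddity_cycle n F. xs = butlast ys))"

definition acyclic_sequence :: "(int \<Rightarrow> int) \<Rightarrow> bool" where
  "acyclic_sequence w \<longleftrightarrow> \<not> (\<exists>xs k. cycle_sequence xs \<and> window w k (length xs) = xs)"

end

(* An SL2-tiling with unit first diagonal is determined by its quiddity sequence q through
   M (i+1) j = q i * M i j - M (i-1) j, and the same recurrence governs a positive frieze as
   long as the entries divided by are nonzero.  Hence a cycle sequence of length n - 1 in w
   forces a zero M (k+n) k.  Conversely, if the tiling of w is not positive, take a nonpositive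
   entry M (j+n) j with n minimal; the unimodular rule makes it 0 and its two neighbours 1.
   Choosing the n-th term to be M (j+n-1) (j+1) and repeating periodically gives a tiling that
   changes sign under translation by n, which is a positive frieze of order n. *)
theory Submission
  imports Defs
begin

section \<open>Three-term recurrences on the integers\<close>

definition solves_recurrence :: "(int \<Rightarrow> int) \<Rightarrow> (int \<Rightarrow> int) \<Rightarrow> bool" where
  "solves_recurrence q f \<longleftrightarrow> (\<forall>i. f (i + 1) = q i * f i - f (i - 1))"

lemma solves_recurrence_exists: "\<exists>f. solves_recurrence q f \<and> f 0 = a \<and> f 1 = b"
proof -
  \<comment> \<open>\<open>P n\<close> carries the values of the solution at \<open>n\<close> and
    \<open>n + 1\<close>, and \<open>N n\<close> those at \<open>- n\<close> and
    \<open>1 - n\<close>. The backward step needs no division because \<open>f (i - 1)\<close> has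
    coefficient -1.\<close>
  define P where "P = rec_nat (a, b) (\<lambda>n (x, y). (y, q (int n + 1) * y - x))"
  define N where "N = rec_nat (a, b) (\<lambda>n (x, y). (q (- int n) * x - y, x))"
  define f where "f i = (if i \<ge> 0 then fst (P (nat i)) else fst (N (nat (- i))))" for i
  have P0: "P 0 = (a, b)" and N0: "N 0 = (a, b)" by (simp_all add: P_def N_def)
  have PS: "P (Suc n) = (snd (P n), q (int n + 1) * snd (P n) - fst (P n))" for n
    by (simp add: P_def case_prod_beta)
  have NS: "N (Suc n) = (q (- int n) * fst (N n) - snd (N n), fst (N n))" for n
    by (simp add: N_def case_prod_beta)
  have "f (i + 1) = q i * f i - f (i - 1)" for i
  proof (cases "i \<ge> 1")
    case True
    define n where "n = nat (i - 1)"
    have i: "i = int n + 1" using True by (simp add: n_def)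
    have "nat (i + 1) = Suc (Suc n)" "nat i = Suc n" "nat (i - 1) = n" by (simp_all add: i)
    then show ?thesis using True by (simp add: f_def PS i)
  next
    case False
    define n where "n = nat (- i)"
    have i: "i = - int n" using False by (simp add: n_def)
    have pred: "f (i - 1) = q i * fst (N n) - snd (N n)"
      by (simp add: f_def i NS nat_add_distrib)
    have cur: "f i = fst (N n)" by (simp add: f_def i P0 N0)
    have "f (i + 1) = snd (N n)"
    proof (cases n)
      case 0
      then show ?thesis by (simp add: f_def i P0 N0 PS nat_eq_iff)
    next
      case (Suc m)
      then show ?thesis by (simp add: f_def i P0 N0 NS)
    qed
    then show ?thesis using pred cur by simp
  qed
  moreover have "f 0 = a" "f 1 = b" by (simp_all add: f_def P0 PS)
  ultimately show ?thesis unfolding solves_recurrence_def by blast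
qed

lemma solves_recurrence_unique:
  assumes f: "solves_recurrence q f" and g: "solves_recurrence q g"
    and "f c = g c" "f (c + 1) = g (c + 1)"
  shows "f i = g i"
proof -
  have "f i = g i \<and> f (i + 1) = g (i + 1)"
  proof (induction i rule: int_induct[where k = c])
    case base
    then show ?case using assms by simp
  next
    case (step1 i)
    then show ?case
      using f[unfolded solves_recurrence_def, rule_format, of "i + 1"]
        g[unfolded solves_recurrence_def, rule_format, of "i + 1"] by simp
  next
    case (step2 i)
    have "f (i - 1) = q i * f i - f (i + 1)" "g (i - 1) = q i * g i - g (i + 1)"
      using f g by (simp_all add: solves_recurrence_def)
    then show ?case using step2 by simp
  qed
  then show ?thesis by simp
qed

section \<open>Tilings with a prescribed quiddity sequence\<close>

text \<open>Positivity is left out, so that such a tiling exists for every integer sequence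
  \<open>q\<close>, including periodic modifications of \<open>w\<close>.\<close>

definition recurrence_tiling :: "(int \<Rightarrow> int) \<Rightarrow> (int \<Rightarrow> int \<Rightarrow> int) \<Rightarrow> bool" where
  "recurrence_tiling q M \<longleftrightarrow>
     SL2_tiling M \<and> (\<forall>i j. M j i = - M i j) \<and> (\<forall>i. M (i + 1) i = 1) \<and>
     (\<forall>j. solves_recurrence q (\<lambda>i. M i j))"

lemma recurrence_tilingD:
  assumes "recurrence_tiling q M"
  shows recurrence_tiling_SL2:
      "M i j * M (i + 1) (j + 1) - M i (j + 1) * M (i + 1) j = 1"
    and recurrence_tiling_antisym: "M j i = - M i j"
    and recurrence_tiling_diag: "M i i = 0"
    and recurrence_tiling_Suc: "M (i + 1) i = 1"
    and recurrence_tiling_rec: "M (i + 1) j = q i * M i j - M (i - 1) j"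
    and recurrence_tiling_quiddity: "M (i + 1) (i - 1) = q i"
proof -
  note D = assms[unfolded recurrence_tiling_def SL2_tiling_def solves_recurrence_def]
  show "M i j * M (i + 1) (j + 1) - M i (j + 1) * M (i + 1) j = 1" "M j i = - M i j"
    and S: "M (i + 1) i = 1" and R: "M (i + 1) j = q i * M i j - M (i - 1) j" for i j
    using D by blast+
  have "M k k = - M k k" for k using D by blast
  then show Z: "M i i = 0" for i by (metis equal_neg_zero)
  show "M (i + 1) (i - 1) = q i" using R[of i "i - 1"] S[of "i - 1"] Z[of "i - 1"] by simp
qed

text \<open>The 2 by 2 determinants formed from two solutions with Casoratian 1 are such a
  tiling.\<close>

lemma recurrence_tiling_exists: "\<exists>M. recurrence_tiling q M"
proof -
  obtain f where f: "solves_recurrence q f" "f 0 = 0" "f 1 = 1"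
    using solves_recurrence_exists by blast
  obtain g where g: "solves_recurrence q g" "g 0 = 1" "g 1 = 0"
    using solves_recurrence_exists by blast
  define M where "M i j = f i * g j - g i * f j" for i j
  have fS: "f (i + 1) = q i * f i - f (i - 1)" and gS: "g (i + 1) = q i * g i - g (i - 1)" for i
    using f g unfolding solves_recurrence_def by blast+
  have W: "f (i + 1) * g i - g (i + 1) * f i = 1" for i
  proof (induction i rule: int_induct[where k = 0])
    case base
    then show ?case by (simp add: f g)
  next
    case (step1 i)
    have "f (i + 1 + 1) = q (i + 1) * f (i + 1) - f i" "g (i + 1 + 1) = q (i + 1) * g (i + 1) - g i"
      using fS[of "i + 1"] gS[of "i + 1"] by simp_all
    then show ?case using step1(2) by algebra
  next
    case (step2 i)
    have "f i * g (i - 1) - g i * f (i - 1) = 1"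
      using step2(2) fS[of i] gS[of i] by algebra
    then show ?case by simp
  qed
  \<comment> \<open>Multiplicativity of the determinant: the 2 by 2 block of \<open>M\<close> is a
    product of two matrices, each with a Casoratian as determinant up to sign.\<close>
  have "M i j * M (i + 1) (j + 1) - M i (j + 1) * M (i + 1) j
      = (f (i + 1) * g i - g (i + 1) * f i) * (f (j + 1) * g j - g (j + 1) * f j)" for i j
    unfolding M_def by algebra
  then have "SL2_tiling M" by (simp add: W SL2_tiling_def)
  moreover have "M (i + 1) i = 1" for i using W by (simp add: M_def)
  moreover have "M (i + 1) j = q i * M i j - M (i - 1) j" for i j
    unfolding M_def fS gS by (simp add: algebra_simps)
  ultimately have "recurrence_tiling q M"
    by (simp add: recurrence_tiling_def solves_recurrence_def M_def)
  then show ?thesis by blast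
qed

text \<open>Column \<open>j\<close> starts with 0 and 1 at rows \<open>j\<close> and
  \<open>j + 1\<close>, and climbing to row \<open>i\<close> uses only the terms of \<open>q\<close>
  strictly between \<open>j\<close> and \<open>i\<close>.\<close>

lemma recurrence_tiling_local:
  assumes M: "recurrence_tiling q M" and M': "recurrence_tiling q' M'"
    and eq: "\<And>i. a < i \<Longrightarrow> i < b \<Longrightarrow> q i = q' i"
    and "a \<le> j" "j \<le> i" "i \<le> b"
  shows "M i j = M' i j"
proof -
  have "j + int r \<le> b \<Longrightarrow> M (j + int r) j = M' (j + int r) j" for r
  proof (induction r rule: less_induct)
    case (less r)
    consider "r = 0" | "r = 1" | s where "r = Suc (Suc s)" by (metis One_nat_def not0_implies_Suc)
    then show ?case
    proof cases
      case 3
      define i where "i = j + int s + 1"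
      have "j + int r = i + 1" by (simp add: 3 i_def)
      moreover have "M i j = M' i j" "M (i - 1) j = M' (i - 1) j"
        using less.IH[of "Suc s"] less.IH[of s] less.prems by (simp_all add: 3 i_def algebra_simps)
      moreover have "q i = q' i"
        using eq less.prems \<open>a \<le> j\<close> by (simp add: 3 i_def)
      ultimately show ?thesis
        using recurrence_tiling_rec[OF M] recurrence_tiling_rec[OF M'] by simp
    qed (simp_all add: recurrence_tiling_diag[OF M] recurrence_tiling_diag[OF M']
        recurrence_tiling_Suc[OF M] recurrence_tiling_Suc[OF M'])
  qed
  from this[of "nat (i - j)"] show ?thesis using assms by simp
qed

text \<open>Translated and negated columns solve the same recurrence, so two initial values settle
  columns 0 and 1. By antisymmetry the recurrence also holds along rows, which carries the sign
  change to every column.\<close>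

lemma recurrence_tiling_antiperiodic:
  assumes M: "recurrence_tiling q M" and per: "\<And>i. q (i + n) = q i"
    and z: "M n 0 = 0" and l: "M (n - 1) 0 = 1" and r: "M n 1 = 1" and c: "M (n - 1) 1 = q n"
  shows "M (i + n) j = - M i j"
proof -
  have shift: "solves_recurrence q (\<lambda>i. M (i + n) j)" for j
    unfolding solves_recurrence_def
  proof
    fix i
    show "M (i + 1 + n) j = q i * M (i + n) j - M (i - 1 + n) j"
      using recurrence_tiling_rec[OF M, of "i + n" j] per[of i] by (simp add: algebra_simps)
  qed
  have neg: "solves_recurrence q (\<lambda>i. - M i j)" for j
    using recurrence_tiling_rec[OF M] by (simp add: solves_recurrence_def)
  have swap: "solves_recurrence q (\<lambda>j. M i j)" for i
    unfolding solves_recurrence_def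
    using recurrence_tiling_rec[OF M, of _ i] recurrence_tiling_antisym[OF M, of i]
    by simp
  have col0: "M (i + n) 0 = - M i 0" for i
    by (rule solves_recurrence_unique[OF shift[of 0] neg[of 0], where c = 0])
      (use z l recurrence_tiling_rec[OF M, of n 0] recurrence_tiling_diag[OF M, of 0]
          recurrence_tiling_Suc[OF M, of 0] in \<open>simp_all add: add.commute\<close>)
  have M01: "M 0 1 = - 1"
    using recurrence_tiling_antisym[OF M, of 1 0] recurrence_tiling_Suc[OF M, of 0] by simp
  \<comment> \<open>Hypothesis \<open>c\<close> makes \<open>M (n + 1) 1\<close> vanish, matching
    \<open>M 1 1 = 0\<close>.\<close>
  have col1: "M (i + n) 1 = - M i 1" for i
    by (rule solves_recurrence_unique[OF shift[of 1] neg[of 1], where c = 0])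
      (use M01 r c recurrence_tiling_rec[OF M, of n 1] recurrence_tiling_diag[OF M, of 1]
        in \<open>simp_all add: add.commute\<close>)
  have "solves_recurrence q (\<lambda>j. - M i j)"
    using swap[of i] by (simp add: solves_recurrence_def)
  from solves_recurrence_unique[OF swap[of "i + n"] this, where c = 0] show ?thesis
    using col0 col1 by simp
qed

section \<open>Windows of sequences\<close>

lemma window_eq_iff:
  "window v k m = window w l m \<longleftrightarrow> (\<forall>i<m. v (k + int i) = w (l + int i))"
  by (auto simp: window_def list_eq_iff_nth_eq)

lemma length_window [simp]: "length (window w k n) = n"
  by (simp add: window_def)

lemma butlast_window: "butlast (window w k n) = window w k (n - 1)"
proof (rule nth_equalityI)
  fix i assume "i < length (butlast (window w k n))"
  then have "i < n - 1" by simp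
  then show "butlast (window w k n) ! i = window w k (n - 1) ! i"
    by (simp add: nth_butlast window_def)
qed simp

section \<open>Arrays determined by their third row\<close>

text \<open>Two adjacent diamonds share a positive entry that can be cancelled. No sign is assumed
  in row \<open>n\<close>, so the result covers both finite friezes and arrays cut from infinite
  ones.\<close>

lemma positive_array_recurrence:
  fixes G :: "nat \<Rightarrow> int \<Rightarrow> int"
  assumes zero: "\<And>k. G 0 k = 0"
    and pos: "\<And>r k. 0 < r \<Longrightarrow> r < n \<Longrightarrow> G r k > 0"
    and dia: "\<And>r k. r + 2 \<le> n \<Longrightarrow>
        G (r + 1) (k - 1) * G (r + 1) k - G r k * G (r + 2) (k - 1) = 1"
    and "r + 2 \<le> n"
  shows "G 1 k = 1" "G (r + 2) k = G 2 (k + int r) * G (r + 1) k - G r k"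
proof -
  have one: "G 1 k = 1" for k
  proof -
    have "G 1 (k - 1) * G 1 k = 1" "G 1 (k - 1) > 0"
      using dia[of 0 k] zero[of k] pos[of 1] \<open>r + 2 \<le> n\<close> by simp_all
    then show ?thesis using pos_zmult_eq_1_iff by blast
  qed
  show "G 1 k = 1" by (rule one)
  show "G (r + 2) k = G 2 (k + int r) * G (r + 1) k - G r k"
    using \<open>r + 2 \<le> n\<close>
  proof (induction r arbitrary: k)
    case 0
    then show ?case using one[of k] zero by (simp add: numeral_2_eq_2)
  next
    case (Suc r)
    let ?q = "G 2 (k + int (Suc r))"
    let ?p = "G (r + 1) (k + 1)"
    have IH: "G (r + 2) (k + 1) = ?q * ?p - G r (k + 1)"
      using Suc.IH[of "k + 1"] Suc.prems by (simp add: algebra_simps)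
    have d1: "G (r + 1) k * ?p - G r (k + 1) * G (r + 2) k = 1"
      using dia[of r "k + 1"] Suc.prems by simp
    have d2: "G (r + 2) k * G (r + 2) (k + 1) - ?p * G (r + 3) k = 1"
      using dia[of "Suc r" "k + 1"] Suc.prems by (simp add: numeral_eq_Suc)
    \<comment> \<open>Eliminating the products of the two diamonds by the induction hypothesis
      leaves the wanted recurrence multiplied by the shared entry \<open>?p\<close>.\<close>
    have "?p * G (r + 3) k = ?p * (?q * G (r + 2) k - G (r + 1) k)"
      using IH d1 d2 by algebra
    moreover have "?p > 0" using pos[of "r + 1" "k + 1"] Suc.prems by simp
    ultimately have "G (r + 3) k = ?q * G (r + 2) k - G (r + 1) k" by simp
    then show ?case by (simp add: numeral_eq_Suc)
  qed
qed

text \<open>By the recurrence, the entry at position \<open>k\<close> of row \<open>n\<close>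
  depends only on the \<open>n - 1\<close> terms of the third row starting at \<open>k\<close>,
  which is the length of a cycle sequence of order \<open>n\<close>.\<close>

lemma positive_arrays_agree:
  fixes G H :: "nat \<Rightarrow> int \<Rightarrow> int"
  assumes "\<And>k. G 0 k = 0" "\<And>r k. 0 < r \<Longrightarrow> r < n \<Longrightarrow> G r k > 0"
    and "\<And>r k. r + 2 \<le> n \<Longrightarrow>
        G (r + 1) (k - 1) * G (r + 1) k - G r k * G (r + 2) (k - 1) = 1"
    and "\<And>k. H 0 k = 0" "\<And>r k. 0 < r \<Longrightarrow> r < n \<Longrightarrow> H r k > 0"
    and "\<And>r k. r + 2 \<le> n \<Longrightarrow>
        H (r + 1) (k - 1) * H (r + 1) k - H r k * H (r + 2) (k - 1) = 1"
    and eq: "\<And>i. i + 1 < n \<Longrightarrow> G 2 (k + int i) = H 2 (l + int i)"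
    and "2 \<le> n" "r \<le> n"
  shows "G r k = H r l"
proof -
  note recG = positive_array_recurrence[where G = G, OF assms(1-3)]
  note recH = positive_array_recurrence[where G = H, OF assms(4-6)]
  show ?thesis using \<open>r \<le> n\<close>
  proof (induction r rule: less_induct)
    case (less r)
    consider "r = 0" | "r = 1" | s where "r = s + 2"
      by (metis One_nat_def add_2_eq_Suc' not0_implies_Suc)
    then show ?case
    proof cases
      case 1
      then show ?thesis using assms by simp
    next
      case 2
      then show ?thesis using recG(1)[where r = 0] recH(1)[where r = 0] \<open>2 \<le> n\<close> by simp
    next
      case 3
      then show ?thesis
        using recG(2)[where r = s and k = k] recH(2)[where r = s and k = l] eq[of s] less.IH[of s] less.IH[of "s + 1"] less.prems
        by simp
    qed
  qed
qed

section \<open>Acyclicity of quiddity sequences\<close>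

text \<open>A cycle sequence of order \<open>n\<close> would force the zero of the last row of a
  finite frieze into an entry of \<open>M\<close> below the diagonal, where all entries are
  positive.\<close>

lemma positive_infinite_frieze_imp_acyclic:
  assumes M: "positive_infinite_frieze M"
  shows "acyclic_sequence (quiddity_sequence M)"
  unfolding acyclic_sequence_def
proof
  assume "\<exists>xs k. cycle_sequence xs \<and> window (quiddity_sequence M) k (length xs) = xs"
  then obtain n F k l where F: "positive_frieze n F"
    and win: "window (quiddity_sequence M) l (n - 1) = window (F 2) k (n - 1)"
    by (auto simp: cycle_sequence_def quiddity_cycle_def butlast_window)
  have n: "2 \<le> n" using F by (simp add: positive_frieze_def)
  \<comment> \<open>The diagonals of \<open>M\<close> become the rows of an array indexed like a
    finite frieze.\<close>
  define H where "H r k = M (k + int r) k" for r k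
  have "M i i = - M i i" for i using M unfolding positive_infinite_frieze_def by blast
  then have diag: "M i i = 0" for i by (metis equal_neg_zero)
  have sl2: "M i j * M (i + 1) (j + 1) - M i (j + 1) * M (i + 1) j = 1" for i j
    using M unfolding positive_infinite_frieze_def SL2_tiling_def by blast
  have pos: "H r k > 0" if "0 < r" for r k
  proof -
    have "M i j > 0" if "j < i" for i j
      using M that unfolding positive_infinite_frieze_def by blast
    then show ?thesis using that by (simp add: H_def)
  qed
  \<comment> \<open>The shift to \<open>l - 1\<close> arises because \<open>H 2 k\<close> is the
    quiddity term with index \<open>k + 1\<close>.\<close>
  have "F n k = H n (l - 1)"
  proof (rule positive_arrays_agree[where n = n and G = F and H = H])
    fix r k
    show "H (r + 1) (k - 1) * H (r + 1) k - H r k * H (r + 2) (k - 1) = 1"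
      using sl2[of "k + int r" "k - 1"] by (simp add: H_def algebra_simps)
  next
    fix i assume "i + 1 < n"
    then have "F 2 (k + int i) = M (l + int i + 1) (l + int i - 1)"
      using win by (auto simp: window_eq_iff quiddity_sequence_def)
    also have "\<dots> = H 2 (l - 1 + int i)" by (simp add: H_def algebra_simps)
    finally show "F 2 (k + int i) = H 2 (l - 1 + int i)" .
  qed (use F n diag pos in \<open>simp_all add: positive_frieze_def H_def\<close>)
  moreover have "F n k = 0" using F by (simp add: positive_frieze_def)
  ultimately show False using pos[of n "l - 1"] n by simp
qed

section \<open>Finite friezes from a zero entry\<close>

lemma recurrence_tiling_translate:
  assumes "recurrence_tiling q M"
  shows "recurrence_tiling (\<lambda>i. q (i + c)) (\<lambda>i j. M (i + c) (j + c))"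
proof -
  have shift: "i + 1 + c = i + c + 1" "i - 1 + c = i + c - 1" for i by simp_all
  show ?thesis
    unfolding recurrence_tiling_def SL2_tiling_def solves_recurrence_def shift
    by (intro conjI allI; rule recurrence_tilingD[OF assms])
qed

lemma cycle_sequence_of_zero:
  assumes W: "recurrence_tiling w M" and wpos: "\<And>i. w i > 0" and n: "2 \<le> n"
    and pos: "\<And>i j. j < i \<Longrightarrow> i < j + int n \<Longrightarrow> M i j > 0"
    and z: "M (int n) 0 = 0" and l: "M (int n - 1) 0 = 1" and r: "M (int n) 1 = 1"
  shows "cycle_sequence (window w 1 (n - 1))"
proof -
  \<comment> \<open>The terms \<open>w 1\<close> to \<open>w (n - 1)\<close> are kept and repeated
    with period \<open>n\<close>; the inserted term is the value that antiperiodicity requires of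
    \<open>q n\<close>.\<close>
  define q where
    "q i = (if i mod int n = 0 then M (int n - 1) 1 else w (i mod int n))" for i
  obtain Q where Q: "recurrence_tiling q Q" using recurrence_tiling_exists by blast
  have qw: "q i = w i" if "0 < i" "i < int n" for i using that by (simp add: q_def)
  have QM: "Q i j = M i j" if "0 \<le> j" "j \<le> i" "i \<le> int n" for i j
    using recurrence_tiling_local[OF Q W qw] that by blast
  have anti: "Q (i + int n) j = - Q i j" for i j
    by (rule recurrence_tiling_antiperiodic[OF Q])
      (use n z l r in \<open>simp_all add: QM q_def\<close>)
  have "Q (i + int n) (j + int n) = Q i j" for i j
    using anti recurrence_tiling_antisym[OF Q] by (metis minus_minus)
  then have per: "Q (i + int n * t) (j + int n * t) = Q i j" for i j t
  proof (induction t rule: int_induct[where k = 0])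
    case base
    then show ?case by simp
  next
    case (step1 t)
    then show ?case by (metis add.assoc distrib_left mult.right_neutral)
  next
    case (step2 t)
    have "Q (i + int n * (t - 1)) (j + int n * (t - 1))
        = Q (i + int n * (t - 1) + int n) (j + int n * (t - 1) + int n)"
      using step2 by simp
    also have "\<dots> = Q (i + int n * t) (j + int n * t)" by (simp add: algebra_simps)
    finally show ?case using step2 by simp
  qed
  define F where "F r k = Q (k + int r) k" for r k
  have Fpos: "F r k > 0" if "0 < r" "r < n" for r k
  \<comment> \<open>Translation by multiples of \<open>n\<close> moves the column into
    \<open>0\<close> to \<open>n - 1\<close>, where \<open>Q\<close> can be compared with
    \<open>M\<close>.\<close>
  proof -
    define p where "p = k mod int n"
    have p: "0 \<le> p" "p < int n" using n by (simp_all add: p_def)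
    have k: "k = p + int n * (k div int n)" by (simp add: p_def)
    have "k + int r = (p + int r) + int n * (k div int n)" using k by simp
    then have F: "F r k = Q (p + int r) p" unfolding F_def using per k by metis
    show ?thesis
    proof (cases "p + int r \<le> int n")
      case True
      then show ?thesis using F QM p pos that by simp
    next
      case False
      \<comment> \<open>Antiperiodicity and antisymmetry combine to a glide reflection, which
        returns an entry beyond row \<open>n\<close> to the triangle where \<open>Q\<close> and
        \<open>M\<close> agree.\<close>
      have "Q (p + int r) p = Q p (p + int r - int n)"
        using anti[of "p + int r - int n" p]
          recurrence_tiling_antisym[OF Q, of p "p + int r - int n"] by simp
      also have "\<dots> = M p (p + int r - int n)" using QM p False that by simp
      also have "\<dots> > 0" using pos that by simp
      finally show ?thesis using F by simp
    qed
  qed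
  have "positive_frieze n F"
    unfolding positive_frieze_def
  proof (intro conjI allI impI)
    fix k
    show "F 0 k = 0" using recurrence_tiling_diag[OF Q] by (simp add: F_def)
    show "F n k = 0" using recurrence_tiling_diag[OF Q] anti by (simp add: F_def)
  next
    fix r k
    show "F (r + 1) (k - 1) * F (r + 1) k - F r k * F (r + 2) (k - 1) = 1"
      using recurrence_tiling_SL2[OF Q, of "k + int r" "k - 1"] by (simp add: F_def algebra_simps)
  qed (use n Fpos in simp_all)
  \<comment> \<open>The window of \<open>F 2\<close> at 0 thus reads \<open>q 1\<close> to
    \<open>q n\<close>, and \<open>butlast\<close> removes exactly the inserted term.\<close>
  moreover have "F 2 k = q (k + 1)" for k
    using recurrence_tiling_quiddity[OF Q, of "k + 1"] by (simp add: F_def algebra_simps)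
  then have "window w 1 (n - 1) = butlast (window (F 2) 0 n)"
    unfolding butlast_window window_eq_iff by (auto simp: qw add.commute)
  moreover have "\<forall>x\<in>set (window w 1 (n - 1)). x > 0" using wpos by (simp add: window_def)
  ultimately show ?thesis unfolding cycle_sequence_def quiddity_cycle_def by blast
qed

section \<open>Positivity from acyclicity\<close>

lemma recurrence_tiling_positive:
  assumes M: "recurrence_tiling w M" and wpos: "\<And>i. w i > 0" and ac: "acyclic_sequence w"
    and "j < i"
  shows "M i j > 0"
proof (rule ccontr)
  assume "\<not> M i j > 0"
  then have "\<exists>r>0. \<exists>j. M (j + int r) j \<le> 0"
    using \<open>j < i\<close> by (intro exI[of _ "nat (i - j)"]) (auto intro!: exI[of _ j])
  then obtain n where n0: "0 < n" and ex: "\<exists>j. M (j + int n) j \<le> 0"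
    and min: "\<And>r. r < n \<Longrightarrow> \<not> (0 < r \<and> (\<exists>j. M (j + int r) j \<le> 0))"
    using exists_least_iff[of "\<lambda>r. 0 < r \<and> (\<exists>j. M (j + int r) j \<le> 0)"] by auto
  from ex obtain c where c: "M (c + int n) c \<le> 0" by blast
  have pos: "M i j > 0" if "j < i" "i < j + int n" for i j
  proof -
    have "j + int (nat (i - j)) = i" "0 < nat (i - j)" "nat (i - j) < n" using that by simp_all
    then show ?thesis using min by (metis not_le)
  qed
  \<comment> \<open>The first two diagonals consist of ones and of terms of \<open>w\<close>. With
    \<open>n\<close> at least 3, the entry \<open>?d\<close> at distance \<open>n - 2\<close> from
    the diagonal is positive by minimality.\<close>
  have "n \<noteq> 1" using c recurrence_tiling_Suc[OF M, of c] by auto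
  moreover have "n \<noteq> 2"
    using c recurrence_tiling_quiddity[OF M, of "c + 1"] wpos[of "c + 1"]
    by (auto simp: algebra_simps)
  ultimately have n: "3 \<le> n" using n0 by simp
  let ?a = "M (c + int n - 1) c" and ?b = "M (c + int n) (c + 1)"
    and ?d = "M (c + int n - 1) (c + 1)" and ?e = "M (c + int n) c"
  have abd: "?a > 0" "?b > 0" "?d > 0" using n by (auto intro: pos)
  have sl2: "?a * ?b - ?d * ?e = 1"
    using recurrence_tiling_SL2[OF M, of "c + int n - 1" c] by simp
  \<comment> \<open>A negative \<open>?e\<close> would make \<open>?a * ?b = 1 + ?d * ?e\<close> at
    most 0, so \<open>?e\<close> is zero and the positive factors of 1 are both 1.\<close>
  have "?a * ?b > 0" using abd by simp
  then have "?d * ?e \<ge> 0" using sl2 by linarith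
  then have e: "?e = 0" using abd c by (simp add: zero_le_mult_iff)
  then have "?a * ?b = 1" using sl2 by simp
  then have a: "?a = 1" and b: "?b = 1"
    using abd pos_zmult_eq_1_iff by (auto simp: mult.commute)
  \<comment> \<open>Translation by \<open>c\<close> puts the zero entry in column 0.\<close>
  have "cycle_sequence (window (\<lambda>i. w (i + c)) 1 (n - 1))"
    by (rule cycle_sequence_of_zero[OF recurrence_tiling_translate[OF M, of c]])
      (use wpos pos n e a b in \<open>simp_all add: algebra_simps\<close>)
  moreover have "window (\<lambda>i. w (i + c)) 1 (n - 1) = window w (c + 1) (n - 1)"
    by (simp add: window_eq_iff algebra_simps)
  ultimately show False using ac unfolding acyclic_sequence_def by (metis length_window)
qed

theorem theorem1p5:
  fixes w :: "int \<Rightarrow> int"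
  assumes "\<forall>i. w i > 0"
  shows "(\<exists>M. positive_infinite_frieze M \<and> quiddity_sequence M = w) \<longleftrightarrow> acyclic_sequence w"
proof
  assume "\<exists>M. positive_infinite_frieze M \<and> quiddity_sequence M = w"
  then show "acyclic_sequence w" using positive_infinite_frieze_imp_acyclic by blast
next
  assume ac: "acyclic_sequence w"
  obtain M where M: "recurrence_tiling w M" using recurrence_tiling_exists by blast
  have "positive_infinite_frieze M"
    unfolding positive_infinite_frieze_def
    using M[unfolded recurrence_tiling_def] recurrence_tiling_positive[OF M _ ac] assms by blast
  moreover have "quiddity_sequence M = w"
    using recurrence_tiling_quiddity[OF M] by (simp add: quiddity_sequence_def)
  ultimately show "\<exists>M. positive_infinite_frieze M \<and> quiddity_sequence M = w" by blast
qed

end
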